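(* Let $l\ge1$, $m>l$, $n>l$ be integers and let $K_m\cup_l K_n$ be the graph on vertex set $V=\{1,2,\dots,m+n-l\}$ with $H_1=\{1,\dots,m\}$, $H_2=\{m-l+1,\dots,m-l+n\}$, in which two distinct vertices $x,y$ are adjacent iff $x,y\in H_1$ or $x,y\in H_2$. Then \[ \mathrm{QEC}(K_m\cup_l K_n)=-1+\frac{-(m-l)(n-l)+\sqrt{mn(m-l)(n-l)}}{m+n-l}. \]
   Context: For a finite connected graph $G=(V,E)$ with $|V|\ge2$, let $D=[d_G(x,y)]_{x,y\in V}$ be its distance matrix ($d_G$ the graph distance). The quadratic embedding constant is $\mathrm{QEC}(G)=\max\{\langle f,Df\rangle : f\in\mathbb{R}^V,\ \langle f,f\rangle=1,\ \langle \mathbf{1},f\rangle=0\}$, where $\mathbf{1}$ is the all-ones vector and $\langle\cdot,\cdot\rangle$ the standard inner product. *)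

theory Defs
  imports Complex_Main
begin

text \<open>A finite simple graph is given by its vertex set \<open>V\<close> and its adjacency relation
  \<open>E\<close>, a symmetric irreflexive relation on \<open>V\<close>.\<close>

definition connected_graph :: "'a set \<Rightarrow> ('a \<times> 'a) set \<Rightarrow> bool" where
  "connected_graph V E \<longleftrightarrow>
     finite V \<and> E \<subseteq> V \<times> V \<and> sym E \<and> irrefl E \<and> (\<forall>x\<in>V. \<forall>y\<in>V. (x, y) \<in> E\<^sup>*)"

text \<open>\<open>(x, y) \<in> E ^^ k\<close> says that there is a walk with \<open>k\<close> edges from \<open>x\<close> to \<open>y\<close>.
  The value is meaningful only when \<open>x\<close> and \<open>y\<close> lie in the same connected component.\<close>

definition graph_dist :: "('a \<times> 'a) set \<Rightarrow> 'a \<Rightarrow> 'a \<Rightarrow> nat" where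
  "graph_dist E x y = (LEAST k. (x, y) \<in> E ^^ k)"

definition dist_matrix :: "('a \<times> 'a) set \<Rightarrow> 'a \<Rightarrow> 'a \<Rightarrow> real" where
  "dist_matrix E x y = real (graph_dist E x y)"

text \<open>Vectors in \<open>\<real>\<^sup>V\<close> are functions \<open>'a \<Rightarrow> real\<close> of which only the values on \<open>V\<close> matter.\<close>

definition inner_on :: "'a set \<Rightarrow> ('a \<Rightarrow> real) \<Rightarrow> ('a \<Rightarrow> real) \<Rightarrow> real" where
  "inner_on V f g = (\<Sum>x\<in>V. f x * g x)"

definition mat_vec_on :: "'a set \<Rightarrow> ('a \<Rightarrow> 'a \<Rightarrow> real) \<Rightarrow> ('a \<Rightarrow> real) \<Rightarrow> 'a \<Rightarrow> real" where
  "mat_vec_on V A f x = (\<Sum>y\<in>V. A x y * f y)"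

text \<open>\<open>GREATEST\<close> denotes a maximum that is attained; unlike \<open>Sup\<close>, it is unspecified otherwise
  (and \<open>Max\<close> is reserved for finite sets).\<close>

definition QEC :: "'a set \<Rightarrow> ('a \<times> 'a) set \<Rightarrow> real" where
  "QEC V E = (GREATEST q. q \<in> {inner_on V f (mat_vec_on V (dist_matrix E) f) | f.
                 inner_on V f f = 1 \<and> inner_on V (\<lambda>_. 1) f = 0})"

definition KK_verts :: "nat \<Rightarrow> nat \<Rightarrow> nat \<Rightarrow> nat set" where
  "KK_verts l m n = {1..m + n - l}"

definition KK_adj :: "nat \<Rightarrow> nat \<Rightarrow> nat \<Rightarrow> (nat \<times> nat) set" where
  "KK_adj l m n = (let H1 = {1..m}; H2 = {m - l + 1..m - l + n} in
     {(x, y). x \<in> KK_verts l m n \<and> y \<in> KK_verts l m n \<and> x \<noteq> y \<and>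
              (x \<in> H1 \<and> y \<in> H1 \<or> x \<in> H2 \<and> y \<in> H2)})"

lemma card_KK_verts:
  assumes "l \<ge> 1" "m > l" "n > l"
  shows "card (KK_verts l m n) \<ge> 2"
  using assms by (simp add: KK_verts_def)

lemma connected_graph_KK:
  assumes "l \<ge> 1" "m > l" "n > l"
  shows "connected_graph (KK_verts l m n) (KK_adj l m n)"
proof -
  have mem: "m \<in> KK_verts l m n"
    using assms by (auto simp: KK_verts_def)
  have to_m: "(x, m) \<in> (KK_adj l m n)\<^sup>*" if "x \<in> KK_verts l m n" for x
  proof (cases "x = m")
    case False
    then have "(x, m) \<in> KK_adj l m n"
      using that assms by (auto simp: KK_adj_def KK_verts_def Let_def)
    then show ?thesis by blast
  qed simp
  have sym: "sym (KK_adj l m n)"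
    by (auto simp: sym_def KK_adj_def Let_def)
  have "(x, y) \<in> (KK_adj l m n)\<^sup>*" if "x \<in> KK_verts l m n" "y \<in> KK_verts l m n" for x y
    using to_m[OF that(1)] to_m[OF that(2)] sym
    by (meson rtrancl_trans sym_rtrancl symD)
  then show ?thesis
    using sym by (auto simp: connected_graph_def KK_verts_def KK_adj_def irrefl_def Let_def)
qed

end

theory Submission
  imports Defs "HOL-Analysis.Convex"
begin

text \<open>Put \<open>a = m - l\<close>, \<open>b = n - l\<close>, and split the vertices into \<open>A = H\<^sub>1 - H\<^sub>2\<close>, \<open>C = H\<^sub>1 \<inter> H\<^sub>2\<close>,
  \<open>B = H\<^sub>2 - H\<^sub>1\<close>. Off the diagonal every distance is 1, except that it is 2 between \<open>A\<close> and \<open>B\<close>.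
  So on unit vectors orthogonal to the constants the form is \<open>-1 + 2 s t\<close>, where \<open>s\<close> and \<open>t\<close> are the
  sums of \<open>f\<close> over \<open>A\<close> and \<open>B\<close>, and \<open>-(s + t)\<close> is its sum over \<open>C\<close>. By Cauchy-Schwarz on each block,
  \<open>s\<^sup>2/a + t\<^sup>2/b + (s + t)\<^sup>2/l \<le> 1\<close>, with equality for block-constant \<open>f\<close>. With
  \<open>\<alpha> = sqrt (a/m)\<close>, \<open>\<beta> = sqrt (b/n)\<close> the left side is \<open>((s/\<alpha>)\<^sup>2 + (t/\<beta>)\<^sup>2 + 2 s t) / l\<close>, so
  AM-GM bounds \<open>2 s t\<close> by \<open>l \<alpha> \<beta> / (1 + \<alpha> \<beta>)\<close>, attained when \<open>s/\<alpha> = t/\<beta>\<close>.\<close>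

section \<open>Distances in the graph\<close>

lemma graph_dist_self: "graph_dist E x x = 0"
  by (simp add: graph_dist_def)

lemma graph_dist_adjacent:
  assumes "(x, y) \<in> E" "x \<noteq> y"
  shows "graph_dist E x y = 1"
  unfolding graph_dist_def
proof (rule Least_equality)
  fix k assume "(x, y) \<in> E ^^ k"
  with assms show "1 \<le> k" by (cases k) auto
qed (use assms in simp)

lemma graph_dist_common_neighbour:
  assumes "(x, z) \<in> E" "(z, y) \<in> E" "(x, y) \<notin> E" "x \<noteq> y"
  shows "graph_dist E x y = 2"
  unfolding graph_dist_def
proof (rule Least_equality)
  show "(x, y) \<in> E ^^ 2"
    using assms by (auto simp: numeral_2_eq_2)
next
  fix k assume k: "(x, y) \<in> E ^^ k"
  have "k \<noteq> 0" "k \<noteq> 1" using k assms(3,4) by (metis pair_in_Id_conv relpow.simps(1), metis relpow_1)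
  then show "2 \<le> k" by simp
qed

text \<open>On vertices, \<open>x \<le> m - l\<close> marks the block A and \<open>m < x\<close> the
  block B. Encoding the extra 1 between A and B by products of an indicator in \<open>x\<close> and
  one in \<open>y\<close> lets the double sum later factor into block sums.\<close>

lemma dist_matrix_KK:
  assumes "l \<ge> 1" "m > l" "n > l" "x \<in> KK_verts l m n" "y \<in> KK_verts l m n"
  shows "dist_matrix (KK_adj l m n) x y =
    1 - of_bool (x = y) + of_bool (x \<le> m - l) * of_bool (m < y) + of_bool (m < x) * of_bool (y \<le> m - l)"
proof -
  consider "x = y" | "x \<noteq> y" "(x, y) \<in> KK_adj l m n"
    | "x \<le> m - l" "m < y" | "m < x" "y \<le> m - l"
    using assms by (fastforce simp: KK_adj_def KK_verts_def Let_def)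
  then show ?thesis
  proof cases
    case 1
    with assms show ?thesis by (auto simp: dist_matrix_def graph_dist_self)
  next
    case 2
    then have "\<not> (x \<le> m - l \<and> m < y)" "\<not> (m < x \<and> y \<le> m - l)"
      using assms by (auto simp: KK_adj_def KK_verts_def Let_def)
    with 2 show ?thesis by (auto simp: dist_matrix_def graph_dist_adjacent)
  next
    case 3
    \<comment> \<open>Since \<open>l \<ge> 1\<close>, the vertex \<open>m\<close> lies in both
      cliques, so it is adjacent to every other vertex.\<close>
    then have "graph_dist (KK_adj l m n) x y = 2"
      using assms
      by (intro graph_dist_common_neighbour[of _ m]) (auto simp: KK_adj_def KK_verts_def Let_def)
    with 3 assms show ?thesis by (auto simp: dist_matrix_def)
  next
    case 4
    then have "graph_dist (KK_adj l m n) x y = 2"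
      using assms
      by (intro graph_dist_common_neighbour[of _ m]) (auto simp: KK_adj_def KK_verts_def Let_def)
    with 4 assms show ?thesis by (auto simp: dist_matrix_def)
  qed
qed

section \<open>The quadratic form as a function of block sums\<close>

lemma sum_KK_verts:
  fixes g :: "nat \<Rightarrow> real"
  assumes "m > l" "n > l"
  shows "sum g (KK_verts l m n) = sum g {1..m - l} + sum g {m - l + 1..m} + sum g {m + 1..m + n - l}"
proof -
  have "KK_verts l m n = ({1..m - l} \<union> {m - l + 1..m}) \<union> {m + 1..m + n - l}"
    using assms by (auto simp: KK_verts_def)
  moreover have "({1..m - l} \<union> {m - l + 1..m}) \<inter> {m + 1..m + n - l} = {}"
    "{1..m - l} \<inter> {m - l + 1..m} = {}"
    by auto
  ultimately show ?thesis
    by (simp only: sum.union_disjoint finite_atLeastAtMost finite_Un)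
qed

text \<open>The distance matrix is J - I + 1_A 1_B^T + 1_B 1_A^T, with J the all-ones matrix; J
  gives the square of the total sum, and each rank-one term gives the product of the sums over A and
  B.\<close>

lemma quadratic_form_KK:
  assumes "l \<ge> 1" "m > l" "n > l"
  shows "inner_on (KK_verts l m n) f (mat_vec_on (KK_verts l m n) (dist_matrix (KK_adj l m n)) f) =
    (inner_on (KK_verts l m n) (\<lambda>_. 1) f)\<^sup>2 - inner_on (KK_verts l m n) f f
      + 2 * sum f {1..m - l} * sum f {m + 1..m + n - l}"
proof -
  let ?V = "KK_verts l m n"
  let ?s = "sum f {1..m - l}" and ?t = "sum f {m + 1..m + n - l}" and ?S = "sum f ?V"
  have fin: "finite ?V" by (simp add: KK_verts_def)
  have A: "(\<Sum>y\<in>?V. of_bool (y \<le> m - l) * f y) = ?s"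
  proof -
    have "(\<Sum>y\<in>?V. of_bool (y \<le> m - l) * f y) = (\<Sum>y\<in>?V. if y \<in> {1..m - l} then f y else 0)"
      by (rule sum.cong) (auto simp: KK_verts_def)
    also have "\<dots> = sum f (?V \<inter> {1..m - l})" using fin by (rule sum.inter_restrict[symmetric])
    also have "?V \<inter> {1..m - l} = {1..m - l}" using assms by (auto simp: KK_verts_def)
    finally show ?thesis .
  qed
  have B: "(\<Sum>y\<in>?V. of_bool (m < y) * f y) = ?t"
  proof -
    have "(\<Sum>y\<in>?V. of_bool (m < y) * f y) = (\<Sum>y\<in>?V. if y \<in> {m + 1..m + n - l} then f y else 0)"
      by (rule sum.cong) (auto simp: KK_verts_def)
    also have "\<dots> = sum f (?V \<inter> {m + 1..m + n - l})" using fin by (rule sum.inter_restrict[symmetric])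
    also have "?V \<inter> {m + 1..m + n - l} = {m + 1..m + n - l}" using assms by (auto simp: KK_verts_def)
    finally show ?thesis .
  qed
  have row: "mat_vec_on ?V (dist_matrix (KK_adj l m n)) f x =
      ?S - f x + of_bool (x \<le> m - l) * ?t + of_bool (m < x) * ?s" if x: "x \<in> ?V" for x
  proof -
    have "mat_vec_on ?V (dist_matrix (KK_adj l m n)) f x =
      (\<Sum>y\<in>?V. f y - of_bool (x = y) * f y + of_bool (x \<le> m - l) * (of_bool (m < y) * f y)
         + of_bool (m < x) * (of_bool (y \<le> m - l) * f y))"
      unfolding mat_vec_on_def
      by (rule sum.cong[OF refl]) (simp only: dist_matrix_KK[OF assms x] algebra_simps mult_1_left)
    also have "\<dots> = ?S - (\<Sum>y\<in>?V. of_bool (x = y) * f y)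
        + of_bool (x \<le> m - l) * ?t + of_bool (m < x) * ?s"
      by (simp only: sum.distrib sum_subtractf sum_distrib_left[symmetric] A B)
    also have "(\<Sum>y\<in>?V. of_bool (x = y) * f y) = f x"
    proof -
      have "(\<Sum>y\<in>?V. of_bool (x = y) * f y) = (\<Sum>y\<in>?V. if x = y then f y else 0)"
        by (rule sum.cong) auto
      then show ?thesis using fin x by simp
    qed
    finally show ?thesis .
  qed
  have "inner_on ?V f (mat_vec_on ?V (dist_matrix (KK_adj l m n)) f) =
    (\<Sum>x\<in>?V. ?S * f x - f x * f x + ?t * (of_bool (x \<le> m - l) * f x) + ?s * (of_bool (m < x) * f x))"
    unfolding inner_on_def by (rule sum.cong[OF refl]) (simp only: row algebra_simps)
  also have "\<dots> = ?S * ?S - (\<Sum>x\<in>?V. f x * f x) + ?t * ?s + ?s * ?t"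
    by (simp only: sum.distrib sum_subtractf sum_distrib_left[symmetric] A B)
  finally show ?thesis by (simp add: inner_on_def power2_eq_square)
qed

section \<open>Block inequality and the extremal problem in two variables\<close>

lemma sum_square_div_card_le:
  fixes f :: "'a \<Rightarrow> real"
  assumes "finite S" "S \<noteq> {}"
  shows "(sum f S)\<^sup>2 / real (card S) \<le> (\<Sum>x\<in>S. f x * f x)"
proof -
  have "card S > 0" using assms by (simp add: card_gt_0_iff)
  then show ?thesis
    using sum_squared_le_sum_of_squares[of f S] assms
    by (simp add: pos_divide_le_eq power2_eq_square)
qed

text \<open>Here \<open>a + l\<close> and \<open>b + l\<close> stand for \<open>m\<close> and \<open>n\<close>, so \<open>r\<close> is \<open>\<alpha> \<beta>\<close>.\<close>

lemma extremal_value_closed_form: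
  fixes a b l :: real
  assumes "a > 0" "b > 0" "l > 0"
  defines "r \<equiv> sqrt (a / (a + l)) * sqrt (b / (b + l))"
  shows "l * r / (1 + r) = (- (a * b) + sqrt ((a + l) * (b + l) * a * b)) / (a + b + l)"
proof -
  define p where "p = sqrt (a * b)"
  define q where "q = sqrt ((a + l) * (b + l))"
  have pq: "p > 0" "q > 0" using assms by (simp_all add: p_def q_def)
  have p2: "p * p = a * b" and q2: "q * q = (a + l) * (b + l)"
    using assms by (simp_all add: p_def q_def)
  have r: "r = p / q"
    by (simp add: r_def p_def q_def real_sqrt_divide real_sqrt_mult)
  have s: "sqrt ((a + l) * (b + l) * a * b) = q * p"
    by (simp add: p_def q_def real_sqrt_mult)
  \<comment> \<open>Rationalises the denominator \<open>q + p\<close>, using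
    \<open>q * q - p * p = l * (a + b + l)\<close>.\<close>
  have eq: "l * p * (a + b + l) = (q * p - p * p) * (q + p)"
  proof -
    have "(q * p - p * p) * (q + p) = p * (q * q - p * p)" by (simp add: algebra_simps)
    also have "\<dots> = l * p * (a + b + l)" unfolding p2 q2 by (simp add: algebra_simps)
    finally show ?thesis by simp
  qed
  have "l * r / (1 + r) = l * p / (q + p)"
    using pq by (simp add: r field_simps)
  also have "\<dots> = (q * p - p * p) / (a + b + l)"
    using pq assms eq by (simp add: frac_eq_eq)
  finally show ?thesis by (simp add: s p2)
qed

text \<open>The coefficient of the square of \<open>s\<close> is
  \<open>1 / a + 1 / l = (a + l) / (a * l)\<close>, and likewise for \<open>t\<close> with
  \<open>b\<close>. Rescaling \<open>s\<close> and \<open>t\<close> thus normalises both squares and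
  leaves the cross term.\<close>

lemma block_form_eq:
  fixes a b l s t :: real
  assumes "a > 0" "b > 0" "l > 0"
  shows "s\<^sup>2 / a + t\<^sup>2 / b + (s + t)\<^sup>2 / l =
    ((s / sqrt (a / (a + l)))\<^sup>2 + (t / sqrt (b / (b + l)))\<^sup>2 + 2 * s * t) / l"
  using assms by (simp add: power_divide) (simp add: field_simps power2_eq_square)

lemma two_product_le_block_form:
  fixes a b l s t :: real
  assumes "a > 0" "b > 0" "l > 0"
  defines "r \<equiv> sqrt (a / (a + l)) * sqrt (b / (b + l))"
  shows "2 * s * t \<le> l * r / (1 + r) * (s\<^sup>2 / a + t\<^sup>2 / b + (s + t)\<^sup>2 / l)"
proof -
  define u where "u = s / sqrt (a / (a + l))"
  define v where "v = t / sqrt (b / (b + l))"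
  have r: "r > 0" using assms by (simp add: r_def)
  have st: "s * t = r * (u * v)"
    using assms by (simp add: r_def u_def v_def)
  have "2 * (u * v) \<le> u\<^sup>2 + v\<^sup>2"
    using sum_squares_bound[of u v] by (simp add: mult.assoc)
  \<comment> \<open>Adding \<open>2 * r * u * v = 2 * s * t\<close> to both sides of AM-GM turns the
    right side into the block form, up to the factor \<open>l\<close>.\<close>
  then have "r * (2 * (u * v) * (1 + r)) \<le> r * (u\<^sup>2 + v\<^sup>2 + 2 * (s * t))"
    using r st by (intro mult_left_mono) (auto simp: algebra_simps)
  then have "2 * (s * t) \<le> r / (1 + r) * (u\<^sup>2 + v\<^sup>2 + 2 * (s * t))"
    using r st by (simp add: field_simps)
  moreover have "l * r / (1 + r) * (s\<^sup>2 / a + t\<^sup>2 / b + (s + t)\<^sup>2 / l) =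
      r / (1 + r) * (u\<^sup>2 + v\<^sup>2 + 2 * (s * t))"
    unfolding block_form_eq[OF assms(1-3)] using assms(3) by (simp add: u_def v_def mult.assoc)
  ultimately show ?thesis unfolding mult.assoc by linarith
qed

lemma two_product_attains_bound:
  fixes a b l :: real
  assumes "a > 0" "b > 0" "l > 0"
  defines "r \<equiv> sqrt (a / (a + l)) * sqrt (b / (b + l))"
  obtains s t where "s\<^sup>2 / a + t\<^sup>2 / b + (s + t)\<^sup>2 / l = 1" "2 * s * t = l * r / (1 + r)"
proof -
  \<comment> \<open>\<open>k\<close> is the common value of the rescaled variables in the equality
    case of AM-GM, chosen so that the block form equals 1.\<close>
  define k where "k = sqrt (l / (2 + 2 * r))"
  have r: "r > 0" using assms by (simp add: r_def)
  have k2: "k * k = l / (2 + 2 * r)" using r assms by (simp add: k_def)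
  define s t where "s = k * sqrt (a / (a + l))" and "t = k * sqrt (b / (b + l))"
  have st: "s * t = k * k * r" by (simp add: s_def t_def r_def)
  have u: "s / sqrt (a / (a + l)) = k" "t / sqrt (b / (b + l)) = k"
    using assms by (simp_all add: s_def t_def)
  have "s\<^sup>2 / a + t\<^sup>2 / b + (s + t)\<^sup>2 / l = (k * k + k * k + 2 * (k * k * r)) / l"
    unfolding block_form_eq[OF assms(1-3)] u by (simp add: power2_eq_square st mult.assoc)
  also have "\<dots> = k * k * (2 + 2 * r) / l" by (simp add: algebra_simps)
  also have "\<dots> = 1" using r assms(3) by (simp add: k2)
  finally have 1: "s\<^sup>2 / a + t\<^sup>2 / b + (s + t)\<^sup>2 / l = 1" .
  have "2 * s * t = 2 * (k * k * r)" using st by simp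
  also have "\<dots> = l * r / (1 + r)" using r by (simp add: k2 field_simps)
  finally show thesis using that 1 by blast
qed

section \<open>The maximum and its closed form\<close>

theorem theorem5p3:
  fixes l m n :: nat
  assumes "l \<ge> 1" and "m > l" and "n > l"
  shows "QEC (KK_verts l m n) (KK_adj l m n) =
    -1 + (- ((real m - real l) * (real n - real l))
          + sqrt (real m * real n * (real m - real l) * (real n - real l)))
         / (real m + real n - real l)"
proof -
  let ?V = "KK_verts l m n" and ?D = "dist_matrix (KK_adj l m n)"
  let ?A = "{1..m - l}" and ?C = "{m - l + 1..m}" and ?B = "{m + 1..m + n - l}"
  define a b c where "a = real m - real l" and "b = real n - real l" and "c = real l"
  have pos: "a > 0" "b > 0" "c > 0" using assms by (simp_all add: a_def b_def c_def)
  have card: "real (card ?A) = a" "real (card ?B) = b" "real (card ?C) = c"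
    using assms by (simp_all add: a_def b_def c_def of_nat_diff)
  define r where "r = sqrt (a / (a + c)) * sqrt (b / (b + c))"
  define L where "L = c * r / (1 + r)"
  have "r > 0" using pos by (simp add: r_def)
  then have "L > 0" using pos by (simp add: L_def)
  have form: "inner_on ?V f (mat_vec_on ?V ?D f) = -1 + 2 * sum f ?A * sum f ?B"
    if "inner_on ?V f f = 1" "inner_on ?V (\<lambda>_. 1) f = 0" for f
    using quadratic_form_KK[OF assms, of f] that by simp
  have "QEC ?V (KK_adj l m n) = -1 + L"
    unfolding QEC_def
  proof (rule Greatest_equality)
    obtain s t where st: "s\<^sup>2 / a + t\<^sup>2 / b + (s + t)\<^sup>2 / c = 1" "2 * s * t = L"
      using two_product_attains_bound[OF pos] unfolding L_def r_def by blast
    \<comment> \<open>Constant on each block, the equality case of Cauchy-Schwarz: each value is the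
      desired block sum divided by the block size, and the sum over C cancels the other two.\<close>
    define f where "f x = (if x \<le> m - l then s / a else if x \<le> m then - (s + t) / c else t / b)" for x
    have fA: "f x = s / a" if "x \<in> ?A" for x using that by (simp add: f_def)
    have fB: "f x = t / b" if "x \<in> ?B" for x using that assms by (auto simp: f_def)
    have fC: "f x = - (s + t) / c" if "x \<in> ?C" for x using that assms by (simp add: f_def)
    have sums: "sum f ?A = s" "sum f ?B = t" "sum f ?C = - (s + t)"
      using pos card by (simp_all add: fA fB fC)
    have "(\<Sum>x\<in>?A. f x * f x) = s\<^sup>2 / a" "(\<Sum>x\<in>?B. f x * f x) = t\<^sup>2 / b"
      "(\<Sum>x\<in>?C. f x * f x) = (s + t)\<^sup>2 / c"
      using pos card by (simp_all add: fA fB fC power2_eq_square) (simp add: algebra_simps)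
    then have norm: "inner_on ?V f f = 1"
      unfolding inner_on_def sum_KK_verts[OF assms(2,3)] using st(1) by linarith
    have orth: "inner_on ?V (\<lambda>_. 1) f = 0"
      unfolding inner_on_def sum_KK_verts[OF assms(2,3)] by (simp only: mult_1_left sums)
    have "inner_on ?V f (mat_vec_on ?V ?D f) = -1 + L"
      unfolding form[OF norm orth] sums st(2) ..
    with norm orth show "-1 + L \<in> {inner_on ?V f (mat_vec_on ?V ?D f) | f.
        inner_on ?V f f = 1 \<and> inner_on ?V (\<lambda>_. 1) f = 0}"
      by (metis (mono_tags, lifting) mem_Collect_eq)
  next
    fix q
    assume "q \<in> {inner_on ?V f (mat_vec_on ?V ?D f) | f.
        inner_on ?V f f = 1 \<and> inner_on ?V (\<lambda>_. 1) f = 0}"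
    then obtain f where q: "q = inner_on ?V f (mat_vec_on ?V ?D f)"
      and norm: "inner_on ?V f f = 1" and orth: "inner_on ?V (\<lambda>_. 1) f = 0"
      by blast
    let ?s = "sum f ?A" and ?t = "sum f ?B"
    \<comment> \<open>Orthogonality to the constants eliminates the sum over C, leaving two free
      variables.\<close>
    have "sum f ?C = - (?s + ?t)"
      using orth unfolding inner_on_def sum_KK_verts[OF assms(2,3)] by simp
    then have C: "(sum f ?C)\<^sup>2 = (?s + ?t)\<^sup>2" by (simp only: power2_minus)
    have "?A \<noteq> {}" "?B \<noteq> {}" "?C \<noteq> {}" using assms by auto
    then have "?s\<^sup>2 / a + ?t\<^sup>2 / b + (?s + ?t)\<^sup>2 / c \<le>
        (\<Sum>x\<in>?A. f x * f x) + (\<Sum>x\<in>?B. f x * f x) + (\<Sum>x\<in>?C. f x * f x)"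
      unfolding card[symmetric] C[symmetric]
      by (intro add_mono sum_square_div_card_le) auto
    also have "\<dots> = 1"
      using norm unfolding inner_on_def sum_KK_verts[OF assms(2,3)] by simp
    finally have "L * (?s\<^sup>2 / a + ?t\<^sup>2 / b + (?s + ?t)\<^sup>2 / c) \<le> L * 1"
      using \<open>L > 0\<close> by (intro mult_left_mono) auto
    moreover have "2 * ?s * ?t \<le> L * (?s\<^sup>2 / a + ?t\<^sup>2 / b + (?s + ?t)\<^sup>2 / c)"
      unfolding L_def r_def by (rule two_product_le_block_form[OF pos])
    ultimately show "q \<le> -1 + L"
      unfolding q form[OF norm orth] by linarith
  qed
  \<comment> \<open>Here \<open>a + c\<close> is \<open>m\<close> and \<open>b + c\<close> is
    \<open>n\<close>, which gives the stated expression.\<close>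
  also have "L = (- (a * b) + sqrt ((a + c) * (b + c) * a * b)) / (a + b + c)"
    unfolding L_def r_def by (rule extremal_value_closed_form[OF pos])
  finally show ?thesis
    by (simp add: a_def b_def c_def)
qed

end
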